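(* Let $\mathcal{B}$ be a Bayesian belief network whose nodes $x_1,\dots,x_n$ are discrete random variables. Then there exists a simultaneous equations model $\mathcal{S}$, involving all the variables $x_1,\dots,x_n$ of $\mathcal{B}$, that is equivalent to $\mathcal{B}$ with respect to the joint probability distribution over $x_1,\dots,x_n$; that is, the joint probability distribution of $(x_1,\dots,x_n)$ induced by $\mathcal{S}$ equals the joint probability distribution represented by $\mathcal{B}$.
   Context: A Bayesian belief network (BBN) with discrete variables consists of a finite directed acyclic graph whose nodes $x_1,\dots,x_n$ are discrete random variables, together with, for each node $x_i$, a conditional probability distribution $\Pr(x_i \mid \pi_i)$ of $x_i$ given each combination of outcomes of the set $\pi_i$ of its direct predecessors (parents) in the graph (a prior distribution if $\pi_i$ is empty). It represents the joint distribution $\Pr(x_1,\dots,x_n)=\prod_{i=1}^n \Pr(x_i\mid \pi_i)$. A simultaneous equations model with variables $x_1,\dots,x_n$ consists of $n$ equations $e_1,\dots,e_n$. Each $e_i$ is a deterministic functional relation of the form $f_i(x_{j_1},\dots,x_{j_r},\mathcal{E}_i)=0$ among a subset $\{x_{j_1},\dots,x_{j_r}\}$ of the variables (the variables occurring in $e_i$) and a latent (error) variable $\mathcal{E}_i$, where $f_i$ is a function. The latent variables $\mathcal{E}_1,\dots,\mathcal{E}_n$ are exogenous, mutually independent random variables with specified distributions. The model is self-contained: the $n$ equations contain exactly the $n$ variables $x_1,\dots,x_n$ (latent variables are not counted), and for every $m$, every subset of $m$ equations contains at least $m$ variables. The model induces a joint distribution on $(x_1,\dots,x_n)$ when, for almost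 every value of $(\mathcal{E}_1,\dots,\mathcal{E}_n)$, the equations have a unique solution $(x_1,\dots,x_n)$ and this solution is a measurable function of $(\mathcal{E}_1,\dots,\mathcal{E}_n)$; the induced joint distribution is then the distribution of this solution. *)

theory Defs
  imports "HOL-Probability.Probability"
begin

text \<open>
  A network on the nodes \<open>{..<n}\<close>. The pair \<open>(j, i)\<close> in \<open>edges\<close> is the arc from \<open>j\<close> to \<open>i\<close>.
  The argument of \<open>cpd B i\<close> is a combination of outcomes of the parents of \<open>i\<close>, given as an
  extensional function on \<open>parents B i\<close>; for a node without parents the only argument is
  \<open>\<lambda>_. undefined\<close>, and \<open>cpd B i\<close> is then a prior distribution.
\<close>

record 'a bbn =
  edges :: "(nat \<times> nat) set"
  outcomes :: "nat \<Rightarrow> 'a set"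
  cpd :: "nat \<Rightarrow> (nat \<Rightarrow> 'a) \<Rightarrow> 'a pmf"

definition parents :: "'a bbn \<Rightarrow> nat \<Rightarrow> nat set" where
  "parents B i = {j. (j, i) \<in> edges B}"

definition is_bbn :: "nat \<Rightarrow> 'a bbn \<Rightarrow> bool" where
  "is_bbn n B \<longleftrightarrow>
     edges B \<subseteq> {..<n} \<times> {..<n} \<and> acyclic (edges B) \<and>
     (\<forall>i<n. countable (outcomes B i)) \<and>
     (\<forall>i<n. \<forall>u \<in> Pi\<^sub>E (parents B i) (outcomes B). set_pmf (cpd B i u) \<subseteq> outcomes B i)"

definition bbn_mass :: "nat \<Rightarrow> 'a bbn \<Rightarrow> (nat \<Rightarrow> 'a) \<Rightarrow> real" where
  "bbn_mass n B x = (\<Prod>i<n. pmf (cpd B i (restrict x (parents B i))) (x i))"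

definition bbn_distribution :: "nat \<Rightarrow> 'a bbn \<Rightarrow> (nat \<Rightarrow> 'a) measure" where
  "bbn_distribution n B =
     density (count_space (Pi\<^sub>E {..<n} (outcomes B))) (\<lambda>x. ennreal (bbn_mass n B x))"

text \<open>
  A simultaneous equations model with \<open>n\<close> equations in variables \<open>x i\<close> (\<open>i < n\<close>), where \<open>x i\<close>
  takes values in the measurable space \<open>X i\<close>. Equation \<open>i\<close> reads
  \<open>eqn S i (restrict x (occ S i)) (e i) = 0\<close>, where \<open>e i\<close> is the value of the \<open>i\<close>-th latent
  variable, which has law \<open>noise S i\<close>.
\<close>

record 'a sem =
  occ :: "nat \<Rightarrow> nat set"
  eqn :: "nat \<Rightarrow> (nat \<Rightarrow> 'a) \<Rightarrow> real \<Rightarrow> real"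
  noise :: "nat \<Rightarrow> real measure"

text \<open>
  The function of equation \<open>i\<close> must actually depend on each variable listed in \<open>occ S i\<close>.
  Otherwise one could list all variables in every equation and self-containedness would be void.
  A variable with a single possible value cannot influence any function, so nothing is
  demanded of it.
\<close>

definition depends_on_listed :: "(nat \<Rightarrow> 'a measure) \<Rightarrow> 'a sem \<Rightarrow> nat \<Rightarrow> bool" where
  "depends_on_listed X S i \<longleftrightarrow>
     (\<forall>j \<in> occ S i. (\<exists>c. space (X j) \<subseteq> {c}) \<or>
        (\<exists>u \<in> Pi\<^sub>E (occ S i) (\<lambda>k. space (X k)). \<exists>a \<in> space (X j). \<exists>t.
           eqn S i u t \<noteq> eqn S i (u(j := a)) t))"

definition self_contained :: "nat \<Rightarrow> 'a sem \<Rightarrow> bool" where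
  "self_contained n S \<longleftrightarrow>
     (\<Union>i<n. occ S i) = {..<n} \<and> (\<forall>A \<subseteq> {..<n}. card A \<le> card (\<Union>i\<in>A. occ S i))"

definition is_sem :: "nat \<Rightarrow> (nat \<Rightarrow> 'a measure) \<Rightarrow> 'a sem \<Rightarrow> bool" where
  "is_sem n X S \<longleftrightarrow>
     (\<forall>i<n. depends_on_listed X S i) \<and>
     (\<forall>i<n. prob_space (noise S i) \<and> sets (noise S i) = sets borel) \<and>
     self_contained n S"

definition solutions :: "nat \<Rightarrow> (nat \<Rightarrow> 'a measure) \<Rightarrow> 'a sem \<Rightarrow> (nat \<Rightarrow> real) \<Rightarrow> (nat \<Rightarrow> 'a) set" where
  "solutions n X S e =
     {x \<in> Pi\<^sub>E {..<n} (\<lambda>i. space (X i)). \<forall>i<n. eqn S i (restrict x (occ S i)) (e i) = 0}"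

text \<open>Mutual independence of the latent variables: their joint law is the product of the \<open>noise S i\<close>.\<close>

definition latent_law :: "nat \<Rightarrow> 'a sem \<Rightarrow> (nat \<Rightarrow> real) measure" where
  "latent_law n S = Pi\<^sub>M {..<n} (noise S)"

definition induces :: "nat \<Rightarrow> (nat \<Rightarrow> 'a measure) \<Rightarrow> 'a sem \<Rightarrow> (nat \<Rightarrow> 'a) measure \<Rightarrow> bool" where
  "induces n X S D \<longleftrightarrow>
     (\<exists>sol \<in> measurable (latent_law n S) (Pi\<^sub>M {..<n} X).
        (AE e in latent_law n S. solutions n X S e = {sol e}) \<and>
        D = distr (latent_law n S) (Pi\<^sub>M {..<n} X) sol)"

end

theory Submission imports Defs begin

text \<open>
  Drive every node by its own uniform variable on the unit interval: the quantile transform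
  turns it into a sample of \<open>cpd B i u\<close> for each combination \<open>u\<close> of parent outcomes, and the
  equation of node \<open>i\<close> says that \<open>x i\<close> is that sample. Acyclicity gives a unique solution for
  every value of the latent variables. A given \<open>x\<close> is the solution iff each latent variable
  lies in the set of values that are mapped to \<open>x i\<close>, so the event is a rectangle, and its
  probability is the product of the conditional probabilities.
\<close>

section \<open>Sampling discrete distributions from one noise law\<close>

text \<open>The law \<open>U\<close> is fixed before \<open>p\<close> and \<open>A\<close>: the
  noise of a node may not depend on the outcomes of its parents, so only the transform
  \<open>h\<close> varies with them. All of \<open>range h\<close> lies in \<open>A\<close>, so that
  a sample is an outcome for every noise value.\<close>

lemma pmf_sampler:
  obtains U :: "real measure" where "prob_space U" "sets U = sets borel"
    "\<And>(p :: 'a pmf) A. countable A \<Longrightarrow> set_pmf p \<subseteq> A \<Longrightarrow>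
       \<exists>h. range h \<subseteq> A \<and> (\<forall>a\<in>A. h -` {a} \<in> sets borel \<and> emeasure U (h -` {a}) = pmf p a)"
proof
  let ?R = "restrict_space lborel {0<..<1::real}"
  let ?U = "distr ?R borel (\<lambda>t. t)"
  have meas: "(\<lambda>t. t) \<in> measurable ?R borel"
    by (intro measurable_restrict_space1) simp
  have "prob_space ?R"
    by (auto simp: space_restrict_space emeasure_restrict_space intro!: prob_spaceI)
  then show "prob_space ?U"
    by (rule prob_space.prob_space_distr[OF _ meas])
  show "sets ?U = sets borel"
    by simp
  fix p :: "'a pmf" and A assume A: "countable A" "set_pmf p \<subseteq> A"
  have ne: "A \<noteq> {}"
    using A(2) set_pmf_not_empty[of p] by blast
  \<comment> \<open>Numbering \<open>A\<close> moves \<open>p\<close> to the real line, where it has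
    a quantile function \<open>M.I\<close>.\<close>
  let ?c = "\<lambda>a. real (to_nat_on A a)"
  let ?M = "distr (measure_pmf p) borel ?c"
  interpret M: cdf_distribution ?M
    unfolding cdf_distribution_def
    by (intro prob_space.real_distribution_distr) (simp_all add: measure_pmf.prob_space_axioms)
  \<comment> \<open>Measurability of \<open>M.I\<close> is known on the open unit interval only. The
    complement is a null set for \<open>?U\<close>, so any constant will do there.\<close>
  define I where "I = (\<lambda>t. if t \<in> {0<..<1} then M.I t else 0)"
  have I_meas: "I \<in> borel_measurable borel"
  proof -
    have "{t::real. 0 < t \<and> t < 1} = {0<..<1}"
      by auto
    then show ?thesis
      unfolding I_def using M.measurable_CI by (subst measurable_If_restrict_space_iff) auto
  qed
  \<comment> \<open>Decoding the number. \<open>from_nat_into\<close> stays in \<open>A\<close> even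
    at numbers that code nothing.\<close>
  define h where "h t = from_nat_into A (nat \<lfloor>I t\<rfloor>)" for t
  show "\<exists>h. range h \<subseteq> A \<and> (\<forall>a\<in>A. h -` {a} \<in> sets borel \<and> emeasure ?U (h -` {a}) = pmf p a)"
  proof (intro exI conjI ballI)
    show "range h \<subseteq> A"
      using from_nat_into[OF ne] by (auto simp: h_def)
    fix a assume "a \<in> A"
    define S where "S = {y::real. from_nat_into A (nat \<lfloor>y\<rfloor>) = a}"
    have S: "S \<in> sets borel"
      unfolding S_def by measurable
    have vim: "h -` {a} = I -` S"
      by (auto simp: h_def S_def)
    show hb: "h -` {a} \<in> sets borel"
      unfolding vim using measurable_sets[OF I_meas S] by simp
    have "emeasure ?U (h -` {a}) = emeasure ?R (h -` {a} \<inter> space ?R)"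
      by (subst emeasure_distr[OF meas]) (use hb in auto)
    also have "h -` {a} \<inter> space ?R = M.I -` S \<inter> space ?R"
      unfolding vim by (auto simp: I_def space_restrict_space)
    also have "emeasure ?R \<dots> = emeasure (distr ?R borel M.I) S"
      by (subst emeasure_distr) (use S in auto)
    also have "\<dots> = emeasure p (?c -` S)"
      unfolding M.distr_I_eq_M by (subst emeasure_distr) (use S in auto)
    \<comment> \<open>Decoding inverts the numbering on \<open>A\<close>, which carries all the mass
      of \<open>p\<close>.\<close>
    also have "\<dots> = emeasure p {a}"
      using A by (intro emeasure_eq_AE) (auto simp: AE_measure_pmf_iff S_def)
    finally show "emeasure ?U (h -` {a}) = pmf p a"
      by (simp add: emeasure_pmf_single)
  qed
qed

section \<open>Recursion along the arcs of the network\<close>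

lemma is_bbn_wf:
  assumes "is_bbn n B"
  shows "wf (edges B)"
proof (rule finite_acyclic_wf)
  have "edges B \<subseteq> {..<n} \<times> {..<n}"
    using assms by (simp add: is_bbn_def)
  then show "finite (edges B)"
    by (rule finite_subset) simp
  show "acyclic (edges B)"
    using assms by (simp add: is_bbn_def)
qed

lemma is_bbn_parents_subset:
  assumes "is_bbn n B"
  shows "parents B i \<subseteq> {..<n}"
  using assms by (auto simp: is_bbn_def parents_def)

text \<open>The arcs are well-founded, so the values can be computed by recursion from the parents,
  and two solutions agree by induction. No topological order is chosen.\<close>

lemma ex1_acyclic_assignment:
  fixes B :: "'a bbn"
  assumes B: "is_bbn n B"
    and h: "\<And>i u. i < n \<Longrightarrow> u \<in> Pi\<^sub>E (parents B i) (outcomes B) \<Longrightarrow> h i u \<in> outcomes B i"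
  shows "\<exists>!x. x \<in> Pi\<^sub>E {..<n} (outcomes B) \<and> (\<forall>i<n. x i = h i (restrict x (parents B i)))"
proof (rule ex_ex1I)
  define f where "f = wfrec (edges B) (\<lambda>f i. h i (restrict f (parents B i)))"
  have f: "f i = h i (restrict f (parents B i))" for i
  proof -
    have "f i = h i (restrict (cut f (edges B) i) (parents B i))"
      unfolding f_def by (subst wfrec[OF is_bbn_wf[OF B]]) simp
    \<comment> \<open>\<open>cut\<close> keeps \<open>f\<close> on the direct predecessors of
      \<open>i\<close>, and these are the parents.\<close>
    also have "restrict (cut f (edges B) i) (parents B i) = restrict f (parents B i)"
      by (auto simp: cut_def parents_def restrict_def)
    finally show ?thesis .
  qed
  have f_out: "i < n \<longrightarrow> f i \<in> outcomes B i" for i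
  proof (induction i rule: wf_induct_rule[OF is_bbn_wf[OF B]])
    case (1 i)
    have "restrict f (parents B i) \<in> Pi\<^sub>E (parents B i) (outcomes B)"
      using 1 is_bbn_parents_subset[OF B, of i] by (auto simp: parents_def)
    then show ?case
      using h f by metis
  qed
  \<comment> \<open>The recursion also gives values off \<open>{..<n}\<close>. Cutting them away
    makes \<open>f\<close> extensional and changes no parent's value.\<close>
  have "restrict (restrict f {..<n}) (parents B i) = restrict f (parents B i)" for i
    using is_bbn_parents_subset[OF B, of i] by (simp add: Int_absorb1)
  with f_out f show "\<exists>x. x \<in> Pi\<^sub>E {..<n} (outcomes B) \<and> (\<forall>i<n. x i = h i (restrict x (parents B i)))"
    by (intro exI[of _ "restrict f {..<n}"]) auto
next
  fix x y
  assume x: "x \<in> Pi\<^sub>E {..<n} (outcomes B) \<and> (\<forall>i<n. x i = h i (restrict x (parents B i)))"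
    and y: "y \<in> Pi\<^sub>E {..<n} (outcomes B) \<and> (\<forall>i<n. y i = h i (restrict y (parents B i)))"
  have "i < n \<longrightarrow> x i = y i" for i
  proof (induction i rule: wf_induct_rule[OF is_bbn_wf[OF B]])
    case (1 i)
    have "restrict x (parents B i) = restrict y (parents B i)"
      using 1 is_bbn_parents_subset[OF B, of i] by (auto simp: parents_def restrict_def fun_eq_iff)
    then show ?case
      using x y by metis
  qed
  then show "x = y"
    using x y by (intro PiE_ext[of x "{..<n}" "outcomes B"]) auto
qed

text \<open>Outcome sets are not assumed nonempty, but every distribution has a point in its
  support; such points are chosen along the arcs. The assignment serves as a base point when
  dependence on the variables is shown.\<close>

lemma is_bbn_PiE_nonempty:
  assumes B: "is_bbn n B"
  shows "Pi\<^sub>E {..<n} (outcomes B) \<noteq> {}"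
proof -
  define h where "h = (\<lambda>i u. SOME a. a \<in> set_pmf (cpd B i u))"
  have "h i u \<in> outcomes B i"
    if "i < n" "u \<in> Pi\<^sub>E (parents B i) (outcomes B)" for i u
  proof -
    have "h i u \<in> set_pmf (cpd B i u)"
      unfolding h_def by (simp add: some_in_eq set_pmf_not_empty)
    then show ?thesis
      using B that unfolding is_bbn_def by blast
  qed
  from ex1_acyclic_assignment[OF B, of h, OF this] show ?thesis
    by auto
qed

section \<open>The simultaneous equations and their solutions\<close>

text \<open>
  A node with a single outcome gets the void equation \<open>0 = 0\<close> in its own variable, because its
  equation cannot depend on its parents. In all other equations the nonzero values encode the
  argument injectively, so that every listed variable has an influence.
\<close>

definition sampling_sem :: "'a bbn \<Rightarrow> real measure \<Rightarrow> (nat \<Rightarrow> (nat \<Rightarrow> 'a) \<Rightarrow> real \<Rightarrow> 'a) \<Rightarrow> 'a sem" where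
  "sampling_sem B U h =
     \<lparr>occ = (\<lambda>i. if is_singleton (outcomes B i) then {i} else insert i (parents B i)),
      eqn = (\<lambda>i u t.
        if is_singleton (outcomes B i) \<or> u i = h i (restrict u (parents B i)) t then 0
        else 1 + real (to_nat_on (Pi\<^sub>E (insert i (parents B i)) (outcomes B)) u)),
      noise = (\<lambda>i. U)\<rparr>"

text \<open>One point \<open>u\<close> that violates equation \<open>i\<close> at noise 0 serves for
  all \<open>j\<close>. There the value is one plus the code of \<open>u\<close>; changing
  coordinate \<open>j\<close> gives either 0 or one plus another code.\<close>

lemma sampling_sem_depends:
  assumes B: "is_bbn n B" and i: "i < n"
  shows "depends_on_listed (\<lambda>i. count_space (outcomes B i)) (sampling_sem B U h) i"
proof (cases "is_singleton (outcomes B i)")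
  case True
  then show ?thesis
    by (auto simp: depends_on_listed_def sampling_sem_def is_singleton_def)
next
  case False
  let ?P = "Pi\<^sub>E (insert i (parents B i)) (outcomes B)"
  have sub: "insert i (parents B i) \<subseteq> {..<n}"
    using is_bbn_parents_subset[OF B] i by auto
  have P: "countable ?P"
    using B sub by (intro countable_PiE) (auto simp: is_bbn_def intro: finite_subset)
  obtain x where x: "x \<in> Pi\<^sub>E {..<n} (outcomes B)"
    using is_bbn_PiE_nonempty[OF B] by blast
  define w where "w = restrict x (insert i (parents B i))"
  have w: "w \<in> ?P"
    using x sub by (auto simp: w_def)
  have irrefl: "i \<notin> parents B i"
    using B by (auto simp: is_bbn_def parents_def acyclic_def)
  have "x i \<in> outcomes B i"
    using x i by auto
  then obtain b where b: "b \<in> outcomes B i" "b \<noteq> h i (restrict w (parents B i)) 0"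
    using False is_singletonI'[of "outcomes B i"] by blast
  define u where "u = w(i := b)"
  have u: "u \<in> ?P"
    using w b by (auto simp: u_def PiE_iff extensional_def)
  \<comment> \<open>A node is not its own parent, so moving coordinate \<open>i\<close> leaves the
    sampled value in place.\<close>
  have "restrict u (parents B i) = restrict w (parents B i)"
    using irrefl by (auto simp: u_def restrict_def)
  then have ui: "u i \<noteq> h i (restrict u (parents B i)) 0"
    using b by (simp add: u_def)
  have "\<exists>a\<in>outcomes B j. eqn (sampling_sem B U h) i u 0 \<noteq> eqn (sampling_sem B U h) i (u(j := a)) 0"
    if j: "j \<in> insert i (parents B i)" and two: "\<nexists>c. outcomes B j \<subseteq> {c}" for j
  proof -
    obtain a where a: "a \<in> outcomes B j" "a \<noteq> u j"
      using two by blast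
    have "u(j := a) \<in> ?P" "u(j := a) \<noteq> u"
      using u a j by (auto simp: PiE_iff extensional_def fun_eq_iff)
    with P u have "to_nat_on ?P (u(j := a)) \<noteq> to_nat_on ?P u"
      by simp
    then show ?thesis
      using a ui False by (intro bexI[of _ a]) (auto simp: sampling_sem_def)
  qed
  moreover have "occ (sampling_sem B U h) i = insert i (parents B i)"
    using False by (simp add: sampling_sem_def)
  ultimately show ?thesis
    using u unfolding depends_on_listed_def space_count_space by metis
qed

lemma is_sem_sampling_sem:
  assumes B: "is_bbn n B" and U: "prob_space U" "sets U = sets borel"
  shows "is_sem n (\<lambda>i. count_space (outcomes B i)) (sampling_sem B U h)"
proof -
  have occ: "i \<in> occ (sampling_sem B U h) i" "i < n \<Longrightarrow> occ (sampling_sem B U h) i \<subseteq> {..<n}" for i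
    using is_bbn_parents_subset[OF B, of i] by (auto simp: sampling_sem_def)
  \<comment> \<open>Each equation contains its own variable, so the variables of the equations in
    \<open>A\<close> include \<open>A\<close>.\<close>
  have "card A \<le> card (\<Union>i\<in>A. occ (sampling_sem B U h) i)" if "A \<subseteq> {..<n}" for A
  proof (rule card_mono)
    have "(\<Union>i\<in>A. occ (sampling_sem B U h) i) \<subseteq> {..<n}"
      using occ(2) that by blast
    then show "finite (\<Union>i\<in>A. occ (sampling_sem B U h) i)"
      by (rule finite_subset) simp
    show "A \<subseteq> (\<Union>i\<in>A. occ (sampling_sem B U h) i)"
      using occ(1) by blast
  qed
  moreover have "(\<Union>i<n. occ (sampling_sem B U h) i) = {..<n}"
    using occ by blast
  ultimately show ?thesis
    using sampling_sem_depends[OF B] U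
    by (auto simp: is_sem_def self_contained_def sampling_sem_def)
qed

lemma solutions_sampling_sem:
  assumes B: "is_bbn n B"
    and h: "\<And>i u t. i < n \<Longrightarrow> u \<in> Pi\<^sub>E (parents B i) (outcomes B) \<Longrightarrow> h i u t \<in> outcomes B i"
  shows "solutions n (\<lambda>i. count_space (outcomes B i)) (sampling_sem B U h) e =
    {x \<in> Pi\<^sub>E {..<n} (outcomes B). \<forall>i<n. x i = h i (restrict x (parents B i)) (e i)}"
proof -
  have "eqn (sampling_sem B U h) i (restrict x (occ (sampling_sem B U h) i)) (e i) = 0 \<longleftrightarrow>
      x i = h i (restrict x (parents B i)) (e i)"
    if x: "x \<in> Pi\<^sub>E {..<n} (outcomes B)" and i: "i < n" for x i
  proof (cases "is_singleton (outcomes B i)")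
    \<comment> \<open>The equation is void, but its sampling condition holds anyway: both sides lie
      in the same singleton.\<close>
    case True
    have "restrict x (parents B i) \<in> Pi\<^sub>E (parents B i) (outcomes B)"
      using x is_bbn_parents_subset[OF B, of i] by auto
    then have "h i (restrict x (parents B i)) (e i) \<in> outcomes B i" "x i \<in> outcomes B i"
      using h[OF i] x i by auto
    with True show ?thesis
      by (auto simp: sampling_sem_def is_singleton_def)
  next
    case False
    have "restrict (restrict x (insert i (parents B i))) (parents B i) = restrict x (parents B i)"
      by (simp add: Int_absorb1 subset_insertI)
    with False show ?thesis
      by (auto simp: sampling_sem_def simp del: restrict_restrict)
  qed
  then show ?thesis
    by (auto simp: solutions_def)
qed

section \<open>The induced joint distribution\<close>

text \<open>There are countably many assignments, so measurability of the solution and equality of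
  the two laws need checking at single points only.\<close>

lemma induces_sampling_sem:
  fixes B :: "'a bbn"
  assumes B: "is_bbn n B" and U: "prob_space U" "sets U = sets borel"
    and h: "\<And>i u t. i < n \<Longrightarrow> u \<in> Pi\<^sub>E (parents B i) (outcomes B) \<Longrightarrow> h i u t \<in> outcomes B i"
    and h_sets: "\<And>i u a. i < n \<Longrightarrow> u \<in> Pi\<^sub>E (parents B i) (outcomes B) \<Longrightarrow> a \<in> outcomes B i \<Longrightarrow>
      h i u -` {a} \<in> sets borel"
    and h_law: "\<And>i u a. i < n \<Longrightarrow> u \<in> Pi\<^sub>E (parents B i) (outcomes B) \<Longrightarrow> a \<in> outcomes B i \<Longrightarrow>
      emeasure U (h i u -` {a}) = pmf (cpd B i u) a"
  shows "induces n (\<lambda>i. count_space (outcomes B i)) (sampling_sem B U h) (bbn_distribution n B)"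
proof -
  let ?X = "Pi\<^sub>E {..<n} (outcomes B)"
  let ?M = "Pi\<^sub>M {..<n} (\<lambda>i. count_space (outcomes B i))"
  let ?L = "Pi\<^sub>M {..<n} (\<lambda>i. U)"
  have cnt: "countable (outcomes B i)" if "i < n" for i
    using B that by (simp add: is_bbn_def)
  have X: "countable ?X"
    using cnt by (intro countable_PiE) auto
  have M: "?M = count_space ?X"
  proof -
    \<comment> \<open>Countability is known for nodes below \<open>n\<close> only; the other outcome
      sets are replaced by the empty set.\<close>
    let ?A = "\<lambda>i. if i < n then outcomes B i else {}"
    have "?M = Pi\<^sub>M {..<n} (\<lambda>i. count_space (?A i))"
      by (intro PiM_cong) auto
    also have "\<dots> = count_space (Pi\<^sub>E {..<n} ?A)"
      using cnt by (intro count_space_PiM_finite) auto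
    also have "Pi\<^sub>E {..<n} ?A = ?X"
      by (intro PiE_cong) auto
    finally show ?thesis .
  qed
  interpret prob_space U by fact
  interpret product_sigma_finite "\<lambda>i. U"
    by (intro product_sigma_finite.intro sigma_finite_measure_axioms)
  have spU: "space U = UNIV"
    using sets_eq_imp_space_eq[OF U(2)] by simp
  define solves where "solves e x \<longleftrightarrow> x \<in> ?X \<and> (\<forall>i<n. x i = h i (restrict x (parents B i)) (e i))" for e x
  have ex1: "\<exists>!x. solves e x" for e
    unfolding solves_def using ex1_acyclic_assignment[OF B, of "\<lambda>i u. h i u (e i)"] h by blast
  define sol where "sol e = (THE x. solves e x)" for e
  have sol_eq: "sol e = x \<longleftrightarrow> solves e x" for e x
    unfolding sol_def using ex1[of e] theI'[OF ex1[of e]] by blast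
  have pa: "restrict x (parents B i) \<in> Pi\<^sub>E (parents B i) (outcomes B)" if "x \<in> ?X" for x i
    using that is_bbn_parents_subset[OF B, of i] by auto
  \<comment> \<open>Once \<open>x\<close> is fixed, so are all parent outcomes, and equation
    \<open>i\<close> constrains the coordinate \<open>e i\<close> alone.\<close>
  have rect: "sol -` {x} \<inter> space ?L = (\<Pi>\<^sub>E i\<in>{..<n}. h i (restrict x (parents B i)) -` {x i})"
    if "x \<in> ?X" for x
  proof -
    have "sol -` {x} = {e. solves e x}"
      by (simp add: vimage_def sol_eq)
    with that show ?thesis
      by (auto simp: solves_def space_PiM spU PiE_iff)
  qed
  have rect_sets: "h i (restrict x (parents B i)) -` {x i} \<in> sets U" if "x \<in> ?X" "i < n" for x i
    using h_sets[OF that(2) pa[OF that(1)] PiE_mem[OF that(1)]] that(2) U(2) by simp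
  have in_X: "sol e \<in> ?X" for e
    using sol_eq[of e "sol e"] by (simp add: solves_def)
  have sol_meas: "sol \<in> measurable ?L ?M"
    unfolding M measurable_count_space_eq_countable[OF X]
  proof (intro conjI ballI Pi_I in_X)
    fix x assume x: "x \<in> ?X"
    show "sol -` {x} \<inter> space ?L \<in> sets ?L"
      unfolding rect[OF x] using rect_sets[OF x] by (intro sets_PiM_I_finite) auto
  qed
  have "bbn_distribution n B = distr ?L ?M sol"
  proof (rule measure_eqI_countable[OF _ _ X])
    show "sets (bbn_distribution n B) = Pow ?X"
      by (simp add: bbn_distribution_def)
    show "sets (distr ?L ?M sol) = Pow ?X"
      by (simp add: M)
    fix x assume x: "x \<in> ?X"
    have "emeasure (distr ?L ?M sol) {x} = emeasure ?L (\<Pi>\<^sub>E i\<in>{..<n}. h i (restrict x (parents B i)) -` {x i})"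
      by (subst emeasure_distr[OF sol_meas]) (simp_all add: M x rect[OF x])
    also have "\<dots> = (\<Prod>i<n. emeasure U (h i (restrict x (parents B i)) -` {x i}))"
      using rect_sets[OF x] by (intro emeasure_PiM) auto
    also have "\<dots> = (\<Prod>i<n. ennreal (pmf (cpd B i (restrict x (parents B i))) (x i)))"
      using h_law[OF _ pa[OF x] PiE_mem[OF x]] by (intro prod.cong) auto
    also have "\<dots> = ennreal (bbn_mass n B x)"
      by (simp add: bbn_mass_def prod_ennreal)
    also have "\<dots> = emeasure (bbn_distribution n B) {x}"
      using x by (simp add: bbn_distribution_def emeasure_density nn_integral_count_space_indicator[symmetric])
    finally show "emeasure (bbn_distribution n B) {x} = emeasure (distr ?L ?M sol) {x}"
      by simp
  qed
  moreover have "solutions n (\<lambda>i. count_space (outcomes B i)) (sampling_sem B U h) e = {sol e}" for e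
  proof -
    have "solutions n (\<lambda>i. count_space (outcomes B i)) (sampling_sem B U h) e = {x. solves e x}"
      unfolding solves_def by (rule solutions_sampling_sem[OF B h])
    also have "\<dots> = {sol e}"
      by (auto simp flip: sol_eq)
    finally show ?thesis .
  qed
  moreover have "latent_law n (sampling_sem B U h) = ?L"
    by (simp add: latent_law_def sampling_sem_def)
  ultimately show ?thesis
    unfolding induces_def by (intro bexI[of _ sol]) (simp_all only: sol_meas simp_thms AE_I2)
qed

theorem theorem1:
  fixes n :: nat and B :: "'a bbn"
  assumes "is_bbn n B"
  shows "\<exists>S :: 'a sem. is_sem n (\<lambda>i. count_space (outcomes B i)) S \<and>
           induces n (\<lambda>i. count_space (outcomes B i)) S (bbn_distribution n B)"
proof -
  obtain U :: "real measure" where U: "prob_space U" "sets U = sets borel"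
    and sampler: "\<And>(p :: 'a pmf) A. countable A \<Longrightarrow> set_pmf p \<subseteq> A \<Longrightarrow>
       \<exists>h. range h \<subseteq> A \<and> (\<forall>a\<in>A. h -` {a} \<in> sets borel \<and> emeasure U (h -` {a}) = pmf p a)"
    using pmf_sampler[where 'a = 'a] by metis
  \<comment> \<open>The conditions on \<open>i\<close> and \<open>u\<close> stand under the
    quantifier, so that choice yields an \<open>h\<close> defined for all arguments.\<close>
  have "\<exists>h. i < n \<longrightarrow> u \<in> Pi\<^sub>E (parents B i) (outcomes B) \<longrightarrow> range h \<subseteq> outcomes B i \<and>
      (\<forall>a\<in>outcomes B i. h -` {a} \<in> sets borel \<and> emeasure U (h -` {a}) = pmf (cpd B i u) a)" for i u
    using assms sampler[of "outcomes B i" "cpd B i u"] unfolding is_bbn_def by blast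
  then obtain h where h: "\<And>i u. i < n \<Longrightarrow> u \<in> Pi\<^sub>E (parents B i) (outcomes B) \<Longrightarrow>
      range (h i u) \<subseteq> outcomes B i \<and> (\<forall>a\<in>outcomes B i. h i u -` {a} \<in> sets borel \<and>
        emeasure U (h i u -` {a}) = pmf (cpd B i u) a)"
    by metis
  have "is_sem n (\<lambda>i. count_space (outcomes B i)) (sampling_sem B U h)"
    using is_sem_sampling_sem[OF assms U] .
  moreover have "induces n (\<lambda>i. count_space (outcomes B i)) (sampling_sem B U h) (bbn_distribution n B)"
    using h by (intro induces_sampling_sem[OF assms U]) blast+
  ultimately show ?thesis
    by blast
qed

end
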